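(* Let $n\ge0$ be an integer and let $\Lambda\subseteq\mathbb{C}$ be a lattice with $s(\Lambda)>n+1$. Then $\Lambda$ is an interpolating sequence for $\mathcal{F}^{n+1}_2(\mathbb{C})$, i.e. for every $(a_\lambda)_{\lambda\in\Lambda}\in\ell^{2}(\Lambda)$ there exists $F\in\mathcal{F}^{n+1}_2(\mathbb{C})$ with $F(\lambda)e^{-\pi|\lambda|^{2}/2}=a_\lambda$ for all $\lambda\in\Lambda$. Moreover, this interpolation problem is solved by $$F(z)=\sum_{\lambda\in\Lambda}a_\lambda\,e^{\pi\overline{\lambda}z-\pi|\lambda|^{2}/2}\,S^{n}_{\Lambda}(z-\lambda),\qquad S^{n}_{\Lambda}(z)=e^{\pi|z|^{2}}\Big(\frac{d}{dz}\Big)^{n}\Big[e^{-\pi|z|^{2}}\frac{\sigma_\Lambda(z)^{n+1}}{n!\,z}\Big].$$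
   Context: Write $z=x+i\xi\in\mathbb{C}$, $\frac{d}{dz}=\frac12(\partial_x-i\partial_\xi)$, and $dz$ for area measure. $\mathcal{F}^{n+1}_2(\mathbb{C})$ (the true polyanalytic Fock space of order $n+1$) consists of all $F$ with $\int_{\mathbb{C}}|F(z)|^{2}e^{-\pi|z|^{2}}dz<\infty$ for which there is an entire function $H$ with $F(z)=\big(\frac{\pi^{n}}{n!}\big)^{1/2}e^{\pi|z|^{2}}\big(\frac{d}{dz}\big)^{n}\big[e^{-\pi|z|^{2}}H(z)\big]$, with the norm $\big(\int|F|^2e^{-\pi|z|^2}dz\big)^{1/2}$. A lattice is $\Lambda=\{m_1\omega_1+m_2\omega_2:m_1,m_2\in\mathbb{Z}\}$ with $\omega_1,\omega_2\in\mathbb{C}$ linearly independent over $\mathbb{R}$; $s(\Lambda)$ is the area of the parallelogram spanned by $\omega_1,\omega_2$. $\sigma(z)=z\prod_{\lambda\in\Lambda\setminus\{0\}}(1-\frac{z}{\lambda})e^{\frac{z}{\lambda}+\frac{z^{2}}{2\lambda^{2}}}$ is the Weierstrass sigma function of $\Lambda$, and $\sigma_\Lambda(z)=\sigma(z)e^{a z^{2}}$ is the modified sigma function, where $a=a(\Lambda)\in\mathbb{C}$ is a fixed constant chosen so that $|\sigma_\Lambda(z)|\le Ce^{\frac{\pi}{2s(\Lambda)}|z|^{2}}$ for all $z$. *)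

theory Defs
  imports "HOL-Analysis.Analysis"
begin

definition wirtinger :: "(complex \<Rightarrow> complex) \<Rightarrow> complex \<Rightarrow> complex" where
  "wirtinger f z =
     (frechet_derivative f (at z) 1 - \<i> * frechet_derivative f (at z) \<i>) / 2"

definition gauss :: "real \<Rightarrow> complex \<Rightarrow> complex" where
  "gauss c z = complex_of_real (exp (c * norm z ^ 2))"

text \<open>True polyanalytic Fock space of order n+1.\<close>
definition true_poly_fock :: "nat \<Rightarrow> (complex \<Rightarrow> complex) set" where
  "true_poly_fock n =
     {F. integrable lborel (\<lambda>z. norm (F z) ^ 2 * exp (- pi * norm z ^ 2)) \<and>
         (\<exists>H. H holomorphic_on UNIV \<and>
              (\<forall>z. F z = complex_of_real (sqrt (pi ^ n / fact n)) * gauss pi z *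
                     (wirtinger ^^ n) (\<lambda>w. gauss (- pi) w * H w) z))}"

definition lin_indep_R :: "complex \<Rightarrow> complex \<Rightarrow> bool" where
  "lin_indep_R w1 w2 \<longleftrightarrow> (\<forall>r1 r2 :: real. of_real r1 * w1 + of_real r2 * w2 = 0 \<longrightarrow> r1 = 0 \<and> r2 = 0)"

definition lat :: "complex \<Rightarrow> complex \<Rightarrow> complex set" where
  "lat w1 w2 = {of_int m1 * w1 + of_int m2 * w2 | m1 m2 :: int. True}"

definition covol :: "complex \<Rightarrow> complex \<Rightarrow> real" where
  "covol w1 w2 = \<bar>Im (cnj w1 * w2)\<bar>"

text \<open>The Weierstrass product prod_{l in Lambda - 0} (1 - z/l) e^{z/l + z^2/(2 l^2)}
  (absolutely convergent, so enumerated in an arbitrary order), i.e. sigma(z)/z.\<close>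
definition weier_prod :: "complex set \<Rightarrow> complex \<Rightarrow> complex" where
  "weier_prod L z =
     (\<Prod>k. let l = from_nat_into (L - {0}) k in (1 - z / l) * exp (z / l + z ^ 2 / (2 * l ^ 2)))"

definition wsigma :: "complex set \<Rightarrow> complex \<Rightarrow> complex" where
  "wsigma L z = z * weier_prod L z"

definition msigma :: "complex set \<Rightarrow> complex \<Rightarrow> complex \<Rightarrow> complex" where
  "msigma L a z = wsigma L z * exp (a * z ^ 2)"

text \<open>sigma_Lambda(z)/z, i.e. the entire function with the removable singularity at 0 filled.\<close>
definition msigma_quot :: "complex set \<Rightarrow> complex \<Rightarrow> complex \<Rightarrow> complex" where
  "msigma_quot L a z = weier_prod L z * exp (a * z ^ 2)"

lemma msigma_eq: "msigma L a z = z * msigma_quot L a z"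
  by (simp add: msigma_def msigma_quot_def wsigma_def)

text \<open>The entire function sigma_Lambda(z)^{n+1} / (n! z).\<close>
definition sigma_pow_quot :: "complex set \<Rightarrow> complex \<Rightarrow> nat \<Rightarrow> complex \<Rightarrow> complex" where
  "sigma_pow_quot L a n z = z ^ n * msigma_quot L a z ^ (n + 1) / fact n"

lemma sigma_pow_quot_eq:
  "z \<noteq> 0 \<Longrightarrow> sigma_pow_quot L a n z = msigma L a z ^ (n + 1) / (fact n * z)"
  by (simp add: sigma_pow_quot_def msigma_eq power_mult_distrib field_simps)

definition S_fun :: "complex set \<Rightarrow> complex \<Rightarrow> nat \<Rightarrow> complex \<Rightarrow> complex" where
  "S_fun L a n z = gauss pi z * (wirtinger ^^ n) (\<lambda>w. gauss (- pi) w * sigma_pow_quot L a n w) z"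

definition interp_term :: "complex set \<Rightarrow> complex \<Rightarrow> nat \<Rightarrow> (complex \<Rightarrow> complex) \<Rightarrow> complex \<Rightarrow> complex \<Rightarrow> complex" where
  "interp_term L a n c z l =
     c l * exp (of_real pi * cnj l * z - of_real (pi * norm l ^ 2 / 2)) * S_fun L a n (z - l)"

end

theory Submission
  imports Defs "HOL-Complex_Analysis.Complex_Analysis" "HOL-Real_Asymp.Real_Asymp"
begin

text \<open>
  The operator $D_n = e^{\pi|z|^2}\partial^n e^{-\pi|z|^2}$ commutes with the Bargmann-Fock shifts
  $G \mapsto e^{\pi\bar\lambda z - \pi|\lambda|^2/2} G(z-\lambda)$, so the interpolating series is
  $D_n H$ with $H$ the sum of the shifts of $g = \sigma_\Lambda^{n+1}/(n!\,z)$ with weights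
  $a_\lambda$. At a nonzero lattice point $g$ vanishes to order $n+1$, hence $D_n g = 0$ there, while
  $D_n g(0) = 1$; so at each lattice point only one term survives. The condition
  $s(\Lambda) > n+1$ makes the growth exponent of $g$, and by Cauchy's estimates also that of $D_n g$,
  smaller than $\pi/2$. A shift by $\lambda$ is therefore dominated by
  $e^{\pi|z|^2/2} e^{-\delta|z-\lambda|^2}$. Since $\sum_\lambda e^{-\delta|z-\lambda|^2}$ is bounded
  uniformly in $z$, the Cauchy-Schwarz inequality bounds $|F(z)|^2 e^{-\pi|z|^2}$ by a constant times
  $\sum_\lambda |a_\lambda|^2 e^{-\delta|z-\lambda|^2}$, which is integrable.
\<close>

subsection \<open>The operator $e^{\pi|z|^2}\partial^n e^{-\pi|z|^2}$ on entire functions\<close>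

text \<open>
  The operator $D_n$. The coefficients of $D_n$ are antiholomorphic, so $\partial (D_n H) = D_n H'$;
  this gives a recursion without binomial sums.
\<close>
fun fock_deriv :: "nat \<Rightarrow> (complex \<Rightarrow> complex) \<Rightarrow> complex \<Rightarrow> complex" where
  "fock_deriv 0 H z = H z"
| "fock_deriv (Suc n) H z = - of_real pi * cnj z * fock_deriv n H z + fock_deriv n (deriv H) z"

lemma entire_has_field_derivative:
  assumes "H holomorphic_on UNIV"
  shows "(H has_field_derivative deriv H z) (at z)"
  using assms by (simp add: holomorphic_derivI)

lemma entire_deriv: "H holomorphic_on UNIV \<Longrightarrow> deriv H holomorphic_on UNIV"
  by (simp add: holomorphic_deriv)

text \<open>The factors \<open>cnj z\<close> in the recursion differentiate into the
  \<open>cnj h\<close> part only, so the coefficient of \<open>h\<close> is the operator applied to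
  \<open>deriv H\<close>. Only that coefficient is named, because the Wirtinger derivative reads off
  nothing else.\<close>

lemma fock_deriv_has_derivative:
  assumes "H holomorphic_on UNIV"
  shows "\<exists>b. (fock_deriv n H has_derivative (\<lambda>h. fock_deriv n (deriv H) z * h + b * cnj h)) (at z)"
  using assms
proof (induction n arbitrary: H)
  case 0
  have "(H has_derivative (\<lambda>h. deriv H z * h + 0 * cnj h)) (at z)"
    using entire_has_field_derivative[OF 0] by (simp add: has_field_derivative_def)
  moreover have "fock_deriv 0 G = G" for G by (rule ext) simp
  ultimately show ?case by (metis)
next
  case (Suc n)
  obtain b1 where b1: "(fock_deriv n H has_derivative (\<lambda>h. fock_deriv n (deriv H) z * h + b1 * cnj h)) (at z)"
    using Suc by blast
  obtain b2 where b2: "(fock_deriv n (deriv H) has_derivative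
      (\<lambda>h. fock_deriv n (deriv (deriv H)) z * h + b2 * cnj h)) (at z)"
    using Suc.IH[OF entire_deriv[OF Suc.prems]] by blast
  have "((\<lambda>w. - of_real pi * cnj w * fock_deriv n H w + fock_deriv n (deriv H) w) has_derivative
      (\<lambda>h. fock_deriv (Suc n) (deriv H) z * h +
         (- of_real pi * cnj z * b1 - of_real pi * fock_deriv n H z + b2) * cnj h)) (at z)"
    by ((rule derivative_eq_intros b1 b2 refl)+) (auto simp: fun_eq_iff algebra_simps)
  moreover have "fock_deriv (Suc n) H = (\<lambda>w. - of_real pi * cnj w * fock_deriv n H w + fock_deriv n (deriv H) w)"
    by (rule ext) simp
  ultimately show ?case by metis
qed

lemma gauss_has_derivative:
  "(gauss c has_derivative (\<lambda>h. gauss c z * of_real c * (cnj z * h + z * cnj h))) (at z)"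
proof -
  \<comment> \<open>Writing |z|^2 as z * cnj z exposes the \<open>h\<close> and \<open>cnj h\<close>
    parts of the derivative.\<close>
  have eq: "gauss c = (\<lambda>z. exp (of_real c * (z * cnj z)))"
    by (rule ext) (simp add: gauss_def flip: exp_of_real complex_norm_square of_real_power)
  show ?thesis
    unfolding eq
    by (rule has_derivative_eq_rhs[OF has_derivative_compose[OF _ DERIV_exp[unfolded has_field_derivative_def]]],
        (rule derivative_eq_intros refl)+)
       (auto simp: fun_eq_iff algebra_simps)
qed

text \<open>Differentiating the weight brings out - pi * cnj z, and differentiating the other factor
  passes to \<open>deriv H\<close>: this is the recursion of \<open>fock_deriv\<close>, which
  thereby describes the iterated derivatives in the definitions.\<close>

lemma wirtinger_power_gauss:
  assumes "H holomorphic_on UNIV"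
  shows "(wirtinger ^^ n) (\<lambda>w. gauss (- pi) w * H w) = (\<lambda>w. gauss (- pi) w * fock_deriv n H w)"
proof (induction n)
  case (Suc n)
  have "wirtinger (\<lambda>w. gauss (- pi) w * fock_deriv n H w) z = gauss (- pi) z * fock_deriv (Suc n) H z" for z
  proof -
    obtain b where b: "(fock_deriv n H has_derivative (\<lambda>h. fock_deriv n (deriv H) z * h + b * cnj h)) (at z)"
      using fock_deriv_has_derivative[OF assms] by blast
    \<comment> \<open>\<open>b'\<close> is the \<open>cnj h\<close> coefficient given by the product
      rule. For a derivative A h + B cnj h, \<open>wirtinger\<close> returns (A + B - i(iA - iB))/2
      = A.\<close>
    define b' where "b' = gauss (- pi) z * (b - of_real pi * z * fock_deriv n H z)"
    have "((\<lambda>w. gauss (- pi) w * fock_deriv n H w) has_derivative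
       (\<lambda>h. gauss (- pi) z * fock_deriv (Suc n) H z * h + b' * cnj h)) (at z)"
      unfolding b'_def
      by ((rule derivative_eq_intros b gauss_has_derivative refl)+) (auto simp: fun_eq_iff algebra_simps)
    from frechet_derivative_at[OF this]
    have *: "frechet_derivative (\<lambda>w. gauss (- pi) w * fock_deriv n H w) (at z) =
        (\<lambda>h. gauss (- pi) z * fock_deriv (Suc n) H z * h + b' * cnj h)" ..
    show ?thesis
      unfolding wirtinger_def * by (simp add: field_simps del: fock_deriv.simps)
  qed
  then show ?case using Suc by auto
qed auto

lemma continuous_fock_deriv:
  "H holomorphic_on UNIV \<Longrightarrow> continuous_on UNIV (fock_deriv n H)"
  by (metis fock_deriv_has_derivative has_derivative_continuous continuous_at_imp_continuous_on)

lemma fock_deriv_lincomb: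
  assumes "G holomorphic_on UNIV" "H holomorphic_on UNIV"
  shows "fock_deriv n (\<lambda>w. a * G w + b * H w) z = a * fock_deriv n G z + b * fock_deriv n H z"
  using assms
proof (induction n arbitrary: G H)
  case (Suc n)
  have "deriv (\<lambda>w. a * G w + b * H w) = (\<lambda>w. a * deriv G w + b * deriv H w)"
    by (rule ext, rule DERIV_imp_deriv)
       (rule derivative_eq_intros entire_has_field_derivative Suc.prems refl | simp)+
  then show ?case
    using Suc by (simp add: entire_deriv algebra_simps)
qed auto

lemma entire_translate:
  assumes "G holomorphic_on UNIV"
  shows "(\<lambda>w. exp (c * w) * G (w - l)) holomorphic_on UNIV"
proof -
  have "(G \<circ> (\<lambda>w. w - l)) holomorphic_on UNIV"
    by (rule holomorphic_on_compose_gen[OF _ assms]) (auto intro!: holomorphic_intros)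
  then show ?thesis
    by (auto intro!: holomorphic_intros simp: o_def)
qed

text \<open>Differentiating the exponential brings out pi * cnj l, which turns the coefficient - pi
  * cnj z of the recursion into - pi * cnj (z - l).\<close>

lemma fock_deriv_shift:
  assumes "G holomorphic_on UNIV"
  shows "fock_deriv n (\<lambda>w. exp (of_real pi * cnj l * w) * G (w - l)) z =
     exp (of_real pi * cnj l * z) * fock_deriv n G (z - l)"
  using assms
proof (induction n arbitrary: G)
  case (Suc n)
  let ?E = "\<lambda>w. exp (of_real pi * cnj l * w)"
  \<comment> \<open>The explicit factor 1 gives the derivative the shape of
    \<open>fock_deriv_lincomb\<close>.\<close>
  have der: "deriv (\<lambda>w. ?E w * G (w - l)) =
      (\<lambda>w. (of_real pi * cnj l) * (?E w * G (w - l)) + 1 * (?E w * deriv G (w - l)))"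
  proof (rule ext, rule DERIV_imp_deriv)
    fix w
    have "((\<lambda>w. w - l) has_field_derivative 1) (at w)"
      by (auto intro!: derivative_eq_intros)
    from DERIV_chain'[OF this entire_has_field_derivative[OF Suc.prems]]
    have G': "((\<lambda>w. G (w - l)) has_field_derivative deriv G (w - l)) (at w)"
      by simp
    show "((\<lambda>w. ?E w * G (w - l)) has_field_derivative
      (of_real pi * cnj l) * (?E w * G (w - l)) + 1 * (?E w * deriv G (w - l))) (at w)"
      by ((rule derivative_eq_intros refl G')+) (simp add: algebra_simps)
  qed
  have "fock_deriv n (deriv (\<lambda>w. ?E w * G (w - l))) z =
      of_real pi * cnj l * (?E z * fock_deriv n G (z - l)) + ?E z * fock_deriv n (deriv G) (z - l)"
    unfolding der
    by (subst fock_deriv_lincomb)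
       (simp_all add: entire_translate entire_deriv Suc.prems
          Suc.IH[OF Suc.prems] Suc.IH[OF entire_deriv[OF Suc.prems]])
  then show ?case
    using Suc.IH[OF Suc.prems] by (simp add: algebra_simps)
qed auto

section \<open>Zeros of the operator's image and its value at the origin\<close>

lemma fock_deriv_zero:
  assumes "\<And>k. k \<le> n \<Longrightarrow> (deriv ^^ k) G z = 0"
  shows "fock_deriv n G z = 0"
  using assms
proof (induction n arbitrary: G)
  case (Suc n)
  have "fock_deriv n (deriv G) z = 0"
    using Suc.prems[of "Suc _"] by (intro Suc.IH) (simp add: funpow_swap1)
  then show ?case using Suc by simp
qed force

lemma fock_deriv_at_0: "fock_deriv n G 0 = (deriv ^^ n) G 0"
  by (induction n arbitrary: G) (simp_all add: funpow_swap1)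

text \<open>Each differentiation costs at most one power of \<open>Q\<close>; everything else it
  produces goes into the cofactor, hence the induction over arbitrary \<open>f\<close>.\<close>

lemma higher_deriv_mult_power_zero:
  assumes "f holomorphic_on UNIV" "Q holomorphic_on UNIV" "Q z = 0" "k < m"
  shows "(deriv ^^ k) (\<lambda>w. f w * Q w ^ m) z = 0"
  using assms
proof (induction k arbitrary: f m)
  case (Suc k)
  then obtain m' where m: "m = Suc m'" by (cases m) auto
  have "deriv (\<lambda>w. f w * Q w ^ m) = (\<lambda>w. (deriv f w * Q w + of_nat m * f w * deriv Q w) * Q w ^ m')"
    by (rule ext, rule DERIV_imp_deriv)
       (rule derivative_eq_intros entire_has_field_derivative Suc.prems refl | simp add: m algebra_simps)+
  moreover have "(\<lambda>w. deriv f w * Q w + of_nat m * f w * deriv Q w) holomorphic_on UNIV"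
    using Suc.prems by (intro holomorphic_intros) auto
  ultimately show ?case
    using Suc m by (simp add: funpow_swap1)
qed (auto simp: power_0_left)

text \<open>One derivative of w^(n+1) h leaves w^n times a new cofactor whose value at 0 is (n+1)
  h(0); the factorial builds up from these values.\<close>

lemma higher_deriv_power_mult_at_0:
  assumes "h holomorphic_on UNIV"
  shows "(deriv ^^ n) (\<lambda>w. w ^ n * h w) 0 = fact n * h 0"
  using assms
proof (induction n arbitrary: h)
  case (Suc n)
  have "deriv (\<lambda>w. w ^ Suc n * h w) = (\<lambda>w. w ^ n * (of_nat (Suc n) * h w + w * deriv h w))"
    by (rule ext, rule DERIV_imp_deriv)
       (rule derivative_eq_intros entire_has_field_derivative Suc.prems refl | simp add: algebra_simps)+
  moreover have "(\<lambda>w. of_nat (Suc n) * h w + w * deriv h w) holomorphic_on UNIV"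
    using Suc.prems by (intro holomorphic_intros) auto
  ultimately show ?case
    using Suc.IH by (simp add: funpow_swap1 del: power_Suc of_nat_Suc)
qed auto

subsection \<open>Growth, and interchange with locally uniform sums\<close>

text \<open>Cauchy's estimate on the unit circle about z replaces |z| by |z| + 1; the resulting
  linear term in the exponent is absorbed by the gap \<open>\<beta> - \<alpha>\<close>.\<close>

lemma entire_deriv_growth:
  assumes hol: "H holomorphic_on UNIV"
    and growth: "\<And>z. norm (H z) \<le> C * exp (\<alpha> * norm z ^ 2)" and ab: "0 \<le> \<alpha>" "\<alpha> < \<beta>"
  shows "\<exists>C'. \<forall>z. norm (deriv H z) \<le> C' * exp (\<beta> * norm z ^ 2)"
proof (intro exI allI)
  fix z :: complex
  define \<delta> where "\<delta> = \<beta> - \<alpha>"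
  have \<delta>: "\<delta> > 0" using ab by (simp add: \<delta>_def)
  have C: "C \<ge> 0" using order_trans[OF norm_ge_zero growth[of 0]] by simp
  have "norm ((deriv ^^ 1) H z) \<le> fact 1 * (C * exp (\<alpha> * (norm z + 1) ^ 2)) / 1 ^ 1"
  proof (rule Cauchy_inequality)
    fix x assume "norm (z - x) = 1"
    then have "norm x \<le> norm z + 1"
      by (metis add.commute norm_minus_commute norm_triangle_sub)
    then have "\<alpha> * norm x ^ 2 \<le> \<alpha> * (norm z + 1) ^ 2"
      using ab by (intro mult_left_mono power_mono) auto
    then show "norm (H x) \<le> C * exp (\<alpha> * (norm z + 1) ^ 2)"
      using growth[of x] C by (meson exp_le_cancel_iff mult_left_mono order_trans)
  qed (auto intro: holomorphic_on_subset[OF hol] holomorphic_on_imp_continuous_on)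
  moreover have "\<alpha> * (norm z + 1) ^ 2 \<le> (\<alpha> + \<alpha>^2 / \<delta>) + \<beta> * norm z ^ 2"
  proof -
    \<comment> \<open>Completing the square bounds the linear term 2 \<alpha> |z| by \<delta> |z|^2
      plus a constant.\<close>
    have "0 \<le> (\<delta> * norm z - \<alpha>) ^ 2 / \<delta>" using \<delta> by simp
    also have "\<dots> = \<delta> * norm z ^ 2 - 2 * \<alpha> * norm z + \<alpha>^2 / \<delta>"
      using \<delta> by (simp add: field_simps power2_eq_square)
    finally show ?thesis by (simp add: \<delta>_def algebra_simps power2_eq_square)
  qed
  then have "C * exp (\<alpha> * (norm z + 1) ^ 2) \<le> (C * exp (\<alpha> + \<alpha>^2 / \<delta>)) * exp (\<beta> * norm z ^ 2)"
    using C by (simp add: mult.assoc mult_left_mono flip: exp_add)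
  ultimately show "norm (deriv H z) \<le> (C * exp (\<alpha> + \<alpha>^2 / \<delta>)) * exp (\<beta> * norm z ^ 2)"
    by simp
qed

text \<open>Both a derivative and a factor |z| cost an arbitrarily small increase of the exponent,
  so finitely many of them fit below any \<open>\<beta>\<close> above
  \<open>\<alpha>\<close>.\<close>

lemma fock_deriv_growth:
  assumes "H holomorphic_on UNIV"
    and "\<And>z. norm (H z) \<le> C * exp (\<alpha> * norm z ^ 2)" and "0 \<le> \<alpha>" "\<alpha> < \<beta>"
  shows "\<exists>C'. \<forall>z. norm (fock_deriv n H z) \<le> C' * exp (\<beta> * norm z ^ 2)"
  using assms
proof (induction n arbitrary: H C \<alpha> \<beta>)
  case 0
  have "C \<ge> 0" using order_trans[OF norm_ge_zero 0(2)[of 0]] by simp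
  then have "norm (H z) \<le> C * exp (\<beta> * norm z ^ 2)" for z
    using 0 by (intro order_trans[OF 0(2)] mult_left_mono) (auto intro!: mult_right_mono)
  then show ?case by auto
next
  case (Suc n)
  \<comment> \<open>The midpoint splits the gap. The first half pays for D_n H and for H'; the
    second half pays for D_n applied to H' and for the factor |z| in front of D_n H.\<close>
  define \<gamma> where "\<gamma> = (\<alpha> + \<beta>) / 2"
  define \<delta> where "\<delta> = \<beta> - \<gamma>"
  have g: "\<alpha> < \<gamma>" "\<gamma> < \<beta>" "0 \<le> \<gamma>" and \<delta>: "\<delta> > 0"
    using Suc.prems by (auto simp: \<gamma>_def \<delta>_def field_simps)
  obtain C1 where C1: "\<And>z. norm (fock_deriv n H z) \<le> C1 * exp (\<gamma> * norm z ^ 2)"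
    using Suc.IH[OF Suc.prems(1,2,3) g(1)] by blast
  obtain C2 where C2: "\<And>z. norm (deriv H z) \<le> C2 * exp (\<gamma> * norm z ^ 2)"
    using entire_deriv_growth[OF Suc.prems(1,2,3) g(1)] by blast
  obtain C3 where C3: "\<And>z. norm (fock_deriv n (deriv H) z) \<le> C3 * exp (\<beta> * norm z ^ 2)"
    using Suc.IH[OF entire_deriv[OF Suc.prems(1)] C2 g(3,2)] by blast
  have C1_nonneg: "C1 \<ge> 0" using order_trans[OF norm_ge_zero C1[of 0]] by simp
  have "norm (fock_deriv (Suc n) H z) \<le> (pi * exp (1 / (4 * \<delta>)) * C1 + C3) * exp (\<beta> * norm z ^ 2)" for z
  proof -
    \<comment> \<open>A square again: |z| is at most \<delta> |z|^2 + 1/(4 \<delta>), hence at most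
      the exponential of that.\<close>
    have "0 \<le> (2 * \<delta> * norm z - 1) ^ 2 / (4 * \<delta>)" using \<delta> by simp
    also have "\<dots> = \<delta> * norm z ^ 2 + 1 / (4 * \<delta>) - norm z"
      using \<delta> by (simp add: field_simps power2_eq_square)
    finally have "norm z \<le> exp (\<delta> * norm z ^ 2 + 1 / (4 * \<delta>))"
      using exp_ge_add_one_self[of "\<delta> * norm z ^ 2 + 1 / (4 * \<delta>)"] by linarith
    then have "norm z * norm (fock_deriv n H z) \<le>
        exp (\<delta> * norm z ^ 2 + 1 / (4 * \<delta>)) * (C1 * exp (\<gamma> * norm z ^ 2))"
      by (intro mult_mono C1) auto
    also have "\<dots> = exp (1 / (4 * \<delta>)) * C1 * exp (\<beta> * norm z ^ 2)"
      by (simp add: \<delta>_def algebra_simps flip: exp_add)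
    finally have "pi * (norm z * norm (fock_deriv n H z)) \<le> pi * (exp (1 / (4 * \<delta>)) * C1 * exp (\<beta> * norm z ^ 2))"
      by (intro mult_left_mono) auto
    moreover have "norm (fock_deriv (Suc n) H z) \<le> pi * (norm z * norm (fock_deriv n H z)) + norm (fock_deriv n (deriv H) z)"
      unfolding fock_deriv.simps by (rule order_trans[OF norm_triangle_ineq]) (simp add: norm_mult)
    moreover have "(pi * exp (1 / (4 * \<delta>)) * C1 + C3) * exp (\<beta> * norm z ^ 2) =
        pi * (exp (1 / (4 * \<delta>)) * C1 * exp (\<beta> * norm z ^ 2)) + C3 * exp (\<beta> * norm z ^ 2)"
      by (simp add: algebra_simps)
    ultimately show ?thesis using C3[of z] by linarith
  qed
  then show ?case by blast
qed

section \<open>Termwise differentiation of locally dominated sums\<close>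

text \<open>The hypothesis of the Weierstrass M-test, with one majorant per disc. Unordered sums
  allow indexing directly by lattice points.\<close>

definition locally_summable :: "('a \<Rightarrow> complex \<Rightarrow> complex) \<Rightarrow> 'a set \<Rightarrow> bool" where
  "locally_summable f X \<longleftrightarrow>
     (\<forall>x\<in>X. f x holomorphic_on UNIV) \<and>
     (\<forall>R. \<exists>M. M summable_on X \<and> (\<forall>x\<in>X. \<forall>z\<in>cball 0 R. norm (f x z) \<le> M x))"

lemma locally_summable_has_sum:
  assumes "locally_summable f X"
  shows "((\<lambda>x. f x z) has_sum (\<Sum>\<^sub>\<infinity>x\<in>X. f x z)) X"
proof -
  obtain M where "M summable_on X" "\<forall>x\<in>X. \<forall>w\<in>cball 0 (norm z). norm (f x w) \<le> M x"
    using assms unfolding locally_summable_def by blast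
  then have "(\<lambda>x. norm (f x z)) summable_on X"
    by (intro Infinite_Sum.abs_summable_on_comparison_test'[of M]) auto
  then show ?thesis
    by (metis abs_summable_summable has_sum_infsum)
qed

text \<open>By Cauchy's estimate with radius 1, a majorant on the disc of radius R + 1 also bounds
  the derivatives on the disc of radius R.\<close>

lemma locally_summable_deriv:
  assumes "locally_summable f X"
  shows "locally_summable (\<lambda>x. deriv (f x)) X"
  unfolding locally_summable_def
proof (intro conjI ballI allI)
  fix R :: real
  obtain M where M: "M summable_on X" "\<And>x w. x \<in> X \<Longrightarrow> w \<in> cball 0 (R + 1) \<Longrightarrow> norm (f x w) \<le> M x"
    using assms unfolding locally_summable_def by blast
  have "norm (deriv (f x) z) \<le> M x" if x: "x \<in> X" and z: "z \<in> cball 0 R" for x z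
  proof -
    have hol: "f x holomorphic_on UNIV" using assms x by (simp add: locally_summable_def)
    have "norm ((deriv ^^ 1) (f x) z) \<le> fact 1 * M x / 1 ^ 1"
    proof (rule Cauchy_inequality)
      fix w assume "norm (z - w) = 1"
      then have "norm w \<le> R + 1"
        using z norm_triangle_sub[of w z] by (simp add: norm_minus_commute)
      then show "norm (f x w) \<le> M x" using M(2)[OF x] by simp
    qed (auto intro: holomorphic_on_subset[OF hol] holomorphic_on_imp_continuous_on)
    then show ?thesis by simp
  qed
  then show "\<exists>M. M summable_on X \<and> (\<forall>x\<in>X. \<forall>z\<in>cball 0 R. norm (deriv (f x) z) \<le> M x)"
    using M(1) by blast
qed (use assms in \<open>auto simp: locally_summable_def intro: entire_deriv\<close>)

text \<open>The M-test makes the finite partial sums converge uniformly on discs, along the filter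
  of finite subsets. Such limits are holomorphic and their derivatives converge too; convergence
  along this filter is what \<open>has_sum\<close> means.\<close>

lemma
  assumes "locally_summable f X"
  shows locally_summable_infsum_entire: "(\<lambda>z. \<Sum>\<^sub>\<infinity>x\<in>X. f x z) holomorphic_on UNIV"
    and locally_summable_deriv_infsum:
      "deriv (\<lambda>z. \<Sum>\<^sub>\<infinity>x\<in>X. f x z) = (\<lambda>z. \<Sum>\<^sub>\<infinity>x\<in>X. deriv (f x) z)"
proof -
  let ?F = "\<lambda>z. \<Sum>\<^sub>\<infinity>x\<in>X. f x z"
  let ?P = "\<lambda>S z. \<Sum>x\<in>S. f x z"
  have hol: "f x holomorphic_on UNIV" if "x \<in> X" for x
    using assms that by (simp add: locally_summable_def)
  have ul: "uniform_limit (cball 0 R) ?P ?F (finite_subsets_at_top X)" for R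
  proof -
    obtain M where "M summable_on X" "\<forall>x\<in>X. \<forall>w\<in>cball 0 R. norm (f x w) \<le> M x"
      using assms unfolding locally_summable_def by blast
    then show ?thesis by (intro Weierstrass_m_test_general[of X _ f M]) auto
  qed
  have ev: "\<forall>\<^sub>F S in finite_subsets_at_top X. finite S \<and> S \<subseteq> X"
    by (simp add: eventually_finite_subsets_at_top_weakI)
  have nb: "finite_subsets_at_top X \<noteq> bot"
    by (rule finite_subsets_at_top_neq_bot)
  have hol_P: "?P S holomorphic_on A" if "S \<subseteq> X" for S A
    using that hol by (intro holomorphic_on_sum) (auto intro: holomorphic_on_subset)
  have "?F holomorphic_on ball 0 R" for R
    by (rule holomorphic_uniform_limit[OF _ ul[of R] nb])
       (rule eventually_mono[OF ev], simp add: hol_P holomorphic_on_imp_continuous_on)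
  then have "?F field_differentiable (at z)" for z
    by (metis dist_0_norm holomorphic_on_imp_differentiable_at less_add_one mem_ball open_ball)
  then show "?F holomorphic_on UNIV"
    by (simp add: holomorphic_on_def field_differentiable_at_within)
  show "deriv ?F = (\<lambda>z. \<Sum>\<^sub>\<infinity>x\<in>X. deriv (f x) z)"
  proof
    fix z :: complex
    let ?R = "norm z + 1"
    have "((\<lambda>S. (deriv ^^ 1) (?P S) z) \<longlongrightarrow> (deriv ^^ 1) ?F z) (finite_subsets_at_top X)"
    proof (rule higher_deriv_complex_uniform_limit)
      show "uniform_limit (ball 0 ?R) ?P ?F (finite_subsets_at_top X)"
        by (rule uniform_limit_on_subset[OF ul ball_subset_cball])
      show "\<forall>\<^sub>F S in finite_subsets_at_top X. ?P S holomorphic_on ball 0 ?R"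
        using ev by (rule eventually_mono) (simp add: hol_P)
    qed (use nb in auto)
    moreover have "\<forall>\<^sub>F S in finite_subsets_at_top X. (deriv ^^ 1) (?P S) z = (\<Sum>x\<in>S. deriv (f x) z)"
      using ev
    proof eventually_elim
      case (elim S)
      then have "(?P S has_field_derivative (\<Sum>x\<in>S. deriv (f x) z)) (at z)"
        using hol by (intro DERIV_sum entire_has_field_derivative) auto
      then show ?case by (simp add: DERIV_imp_deriv)
    qed
    ultimately have "((\<lambda>S. \<Sum>x\<in>S. deriv (f x) z) \<longlongrightarrow> deriv ?F z) (finite_subsets_at_top X)"
      by (simp add: tendsto_cong)
    then have "((\<lambda>x. deriv (f x) z) has_sum deriv ?F z) X"
      by (simp add: has_sum_def)
    then show "deriv ?F z = (\<Sum>\<^sub>\<infinity>x\<in>X. deriv (f x) z)"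
      by (simp add: infsumI)
  qed
qed

text \<open>Induction along the recursion; its second summand calls for the family of derivatives,
  so \<open>f\<close> stays arbitrary.\<close>

lemma fock_deriv_has_sum:
  assumes "locally_summable f X"
  shows "((\<lambda>x. fock_deriv n (f x) z) has_sum fock_deriv n (\<lambda>z. \<Sum>\<^sub>\<infinity>x\<in>X. f x z) z) X"
  using assms
proof (induction n arbitrary: f)
  case (Suc n)
  show ?case
    unfolding fock_deriv.simps locally_summable_deriv_infsum[OF Suc.prems]
    by (intro has_sum_add has_sum_cmult_right Suc.IH Suc.prems locally_summable_deriv)
qed (simp add: locally_summable_has_sum)

subsection \<open>Lattice sums\<close>

text \<open>The terms decay like |m|^(-3/2), which is summable, while a product of two of them
  decays slowly enough to dominate an inverse cube on the plane lattice.\<close>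

lemma summable_on_int_powr:
  "(\<lambda>m::int. (1 + real_of_int m ^ 2) powr (-3/4)) summable_on UNIV"
proof -
  let ?g = "\<lambda>m::int. (1 + real_of_int m ^ 2) powr (-3/4)"
  have "summable (\<lambda>n. real n powr (-3/2))"
    by (simp add: summable_real_powr_iff)
  then have "summable (\<lambda>n. (1 + real n ^ 2) powr (-3/4))"
  proof (rule summable_comparison_test_ev[rotated])
    show "\<forall>\<^sub>F n in sequentially. norm ((1 + real n ^ 2) powr (-3/4)) \<le> real n powr (-3/2)"
    proof (rule eventually_mono[OF eventually_gt_at_top[of 0]])
      fix n :: nat assume "n > 0"
      then have "(1 + real n ^ 2) powr (-3/4) \<le> (real n ^ 2) powr (-3/4)"
        by (intro powr_mono2') auto
      also have "\<dots> = real n powr (-3/2)"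
        using \<open>n > 0\<close> powr_powr[of "real n" 2 "-3/4"] by simp
      finally show "norm ((1 + real n ^ 2) powr (-3/4)) \<le> real n powr (-3/2)" by simp
    qed
  qed
  then have nat: "(\<lambda>n. (1 + real n ^ 2) powr (-3/4)) summable_on UNIV"
    by (intro summable_nonneg_imp_summable_on) auto
  have "?g summable_on range int" "?g summable_on range (\<lambda>n. - int n)"
    using nat by (subst summable_on_reindex; simp add: o_def inj_on_def)+
  then have "?g summable_on (range int \<union> range (\<lambda>n. - int n))"
    by (rule summable_on_union)
  moreover have "range int \<union> range (\<lambda>n. - int n) = UNIV"
    by (auto simp: image_iff) (metis int_cases2)
  ultimately show ?thesis by simp
qed

text \<open>An injective linear map on the real plane is bounded below; \<open>\<kappa>\<close> is
  the square of that bound.\<close>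

lemma lattice_norm_lower_bound:
  assumes "lin_indep_R w1 w2"
  obtains \<kappa> where "\<kappa> > 0" "\<And>x y::real. \<kappa> * (x ^ 2 + y ^ 2) \<le> norm (of_real x * w1 + of_real y * w2) ^ 2"
proof -
  define L where "L = (\<lambda>p::real \<times> real. of_real (fst p) * w1 + of_real (snd p) * w2)"
  have lin: "linear L"
    by (rule linearI) (auto simp: L_def algebra_simps scaleR_conv_of_real)
  have "inj L"
    unfolding linear_injective_0[OF lin] using assms by (auto simp: lin_indep_R_def L_def zero_prod_def)
  then obtain B where B: "B > 0" "\<And>p. B * norm p \<le> norm (L p)"
    using linear_inj_bounded_below_pos[OF lin] by blast
  show thesis
  proof
    show "B ^ 2 > 0" using B by simp
    fix x y :: real
    have "(B * norm (x, y)) ^ 2 \<le> norm (L (x, y)) ^ 2"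
      using B by (intro power_mono) auto
    then show "B ^ 2 * (x ^ 2 + y ^ 2) \<le> norm (of_real x * w1 + of_real y * w2) ^ 2"
      by (simp add: L_def norm_Pair power_mult_distrib)
  qed
qed

lemma lattice_bij:
  assumes "lin_indep_R w1 w2"
  shows "bij_betw (\<lambda>(m1, m2). of_int m1 * w1 + of_int m2 * w2) (UNIV :: (int \<times> int) set) (lat w1 w2)"
proof -
  have "m1 = m1' \<and> m2 = m2'"
    if "of_int m1 * w1 + of_int m2 * w2 = of_int m1' * w1 + of_int m2' * w2" for m1 m2 m1' m2' :: int
  proof -
    have "of_real (of_int (m1 - m1')) * w1 + of_real (of_int (m2 - m2')) * w2 = 0"
      using that by (simp add: algebra_simps)
    then have "real_of_int (m1 - m1') = 0 \<and> real_of_int (m2 - m2') = 0"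
      using assms unfolding lin_indep_R_def by blast
    then show ?thesis by simp
  qed
  then show ?thesis
    by (auto simp: bij_betw_def inj_on_def lat_def)
qed

text \<open>The exponent 3 is the one required by Weierstrass factors of degree 2; the Gaussian
  lattice sums are compared with this sum as well.\<close>

lemma lattice_summable_cube:
  assumes "lin_indep_R w1 w2"
  shows "(\<lambda>l. 1 / norm l ^ 3) summable_on lat w1 w2"
proof -
  obtain \<kappa> where \<kappa>: "\<kappa> > 0" "\<And>x y::real. \<kappa> * (x ^ 2 + y ^ 2) \<le> norm (of_real x * w1 + of_real y * w2) ^ 2"
    using lattice_norm_lower_bound[OF assms] by blast
  let ?a = "\<lambda>m::int. (1 + real_of_int m ^ 2) powr (-3/4)"
  let ?l = "\<lambda>(m1, m2). of_int m1 * w1 + of_int m2 * w2"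
  \<comment> \<open>Since $(1+x^2)(1+y^2) \le (1+x^2+y^2)^2$, the sum is dominated by a product of two
    one-dimensional sums.\<close>
  have "(\<lambda>(m1, m2). ?a m1 * ?a m2) summable_on (UNIV \<times> UNIV)"
    using summable_on_int_powr
    by (intro summable_on_SigmaI[where g = "\<lambda>m. ?a m * (\<Sum>\<^sub>\<infinity>k. ?a k)"])
       (auto intro!: has_sum_cmult_right has_sum_infsum summable_on_cmult_left)
  then have "(\<lambda>p. (\<kappa> / 2) powr (-3/2) * (\<lambda>(m1, m2). ?a m1 * ?a m2) p) summable_on UNIV"
    by (intro summable_on_cmult_right) simp
  then have "(\<lambda>p. 1 / norm (?l p) ^ 3) summable_on UNIV"
  proof (rule summable_on_comparison_test)
    fix p :: "int \<times> int"
    obtain m1 m2 where p: "p = (m1, m2)" by (cases p)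
    show "1 / norm (?l p) ^ 3 \<le> (\<kappa> / 2) powr (-3/2) * (\<lambda>(m1, m2). ?a m1 * ?a m2) p"
    proof (cases "?l p = 0")
      case True
      \<comment> \<open>At the origin 1 / 0 = 0, so that point need not be removed.\<close>
      then show ?thesis by (simp add: p)
    next
      case False
      define r where "r = norm (?l p)"
      let ?x = "real_of_int m1" and ?y = "real_of_int m2"
      have r: "r > 0" using False by (simp add: r_def)
      \<comment> \<open>A nonzero integer point has x^2 + y^2 at least 1, so 1 + x^2 + y^2 is at
        most twice x^2 + y^2; this is where \<open>\<kappa> / 2\<close> comes from.\<close>
      have "m1 \<noteq> 0 \<or> m2 \<noteq> 0" using False p by auto
      then have "0 < m1 ^ 2 + m2 ^ 2"
        by (simp add: sum_power2_gt_zero_iff)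
      then have "1 \<le> m1 ^ 2 + m2 ^ 2" by simp
      then have one: "1 \<le> ?x ^ 2 + ?y ^ 2"
        by (metis of_int_1_le_iff of_int_add of_int_power)
      have "\<kappa> / 2 * (1 + (?x ^ 2 + ?y ^ 2)) \<le> \<kappa> / 2 * (2 * (?x ^ 2 + ?y ^ 2))"
        using one \<kappa>(1) by (intro mult_left_mono) auto
      also have "\<dots> \<le> r ^ 2"
        using \<kappa>(2)[of ?x ?y] by (simp add: r_def p algebra_simps)
      finally have le: "\<kappa> / 2 * (1 + (?x ^ 2 + ?y ^ 2)) \<le> r ^ 2" .
      have pos: "0 < 1 + (?x ^ 2 + ?y ^ 2)"
        by (intro add_pos_nonneg) auto
      have "1 / r ^ 3 = (r ^ 2) powr (-3/2)"
        using r powr_powr[of r 2 "-3/2"] by (simp add: powr_minus field_simps)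
      also have "\<dots> \<le> (\<kappa> / 2 * (1 + (?x ^ 2 + ?y ^ 2))) powr (-3/2)"
        using \<kappa>(1) pos le by (intro powr_mono2') (auto intro!: mult_pos_pos)
      also have "\<dots> = (\<kappa> / 2) powr (-3/2) * (((1 + (?x ^ 2 + ?y ^ 2)) ^ 2) powr (-3/4))"
        using \<kappa>(1) pos powr_powr[of "1 + (?x ^ 2 + ?y ^ 2)" 2 "-3/4"]
          powr_mult[of "\<kappa> / 2" "1 + (?x ^ 2 + ?y ^ 2)" "-3/2"] by simp
      also have "\<dots> \<le> (\<kappa> / 2) powr (-3/2) * (((1 + ?x ^ 2) * (1 + ?y ^ 2)) powr (-3/4))"
      proof (intro mult_left_mono powr_mono2')
        have "0 \<le> ?x ^ 2 + ?y ^ 2 + ?x ^ 2 * ?y ^ 2 + ?x ^ 4 + ?y ^ 4"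
          by simp
        then show "(1 + ?x ^ 2) * (1 + ?y ^ 2) \<le> (1 + (?x ^ 2 + ?y ^ 2)) ^ 2"
          by (simp add: algebra_simps power2_eq_square power4_eq_xxxx)
      qed (auto intro!: mult_pos_pos add_pos_nonneg)
      finally show ?thesis
        by (simp add: r_def p powr_mult)
    qed
  qed auto
  then show ?thesis
    using summable_on_reindex_bij_betw[OF lattice_bij[OF assms], of "\<lambda>l. 1 / norm l ^ 3"] by simp
qed

lemma lattice_countable: "countable (lat w1 w2)"
proof -
  have "lat w1 w2 = (\<lambda>(m1, m2). of_int m1 * w1 + of_int m2 * w2) ` (UNIV :: (int \<times> int) set)"
    by (auto simp: lat_def)
  then show ?thesis by simp
qed

lemma lattice_infinite: "lin_indep_R w1 w2 \<Longrightarrow> infinite (lat w1 w2)"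
  using bij_betw_finite[OF lattice_bij] by (simp add: finite_prod infinite_UNIV_int)

lemma zero_in_lattice: "0 \<in> lat w1 w2"
  by (auto simp: lat_def intro!: exI[of _ "0::int"])

lemma lattice_diff:
  assumes "l \<in> lat w1 w2" "m \<in> lat w1 w2"
  shows "l - m \<in> lat w1 w2"
proof -
  obtain a b c d :: int where "l = of_int a * w1 + of_int b * w2" "m = of_int c * w1 + of_int d * w2"
    using assms by (auto simp: lat_def)
  then have "l - m = of_int (a - c) * w1 + of_int (b - d) * w2"
    by (simp add: algebra_simps)
  then show ?thesis unfolding lat_def by blast
qed

lemma lattice_shift_bij:
  assumes "l0 \<in> lat w1 w2"
  shows "bij_betw (\<lambda>l. l - l0) (lat w1 w2) (lat w1 w2)"
proof (rule bij_betwI[where g = "\<lambda>l. l - (0 - l0)"])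
  show "(\<lambda>l. l - (0 - l0)) \<in> lat w1 w2 \<rightarrow> lat w1 w2"
    using assms by (intro Pi_I lattice_diff zero_in_lattice)
qed (use assms in \<open>auto intro: lattice_diff\<close>)

lemma lattice_gaussian_summable:
  assumes "lin_indep_R w1 w2" and \<delta>: "\<delta> > 0"
  shows "(\<lambda>l. exp (- \<delta> * norm l ^ 2)) summable_on lat w1 w2"
proof -
  have "(\<lambda>l. 1 / norm l ^ 3) summable_on (lat w1 w2 - {0})"
    by (rule summable_on_subset_banach[OF lattice_summable_cube[OF assms(1)]]) auto
  then have "(\<lambda>l. (1 / \<delta> + 1 / \<delta> ^ 2) * (1 / norm l ^ 3)) summable_on (lat w1 w2 - {0})"
    by (rule summable_on_cmult_right)
  then have "(\<lambda>l. exp (- \<delta> * norm l ^ 2)) summable_on (lat w1 w2 - {0})"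
  proof (rule summable_on_comparison_test)
    fix l assume "l \<in> lat w1 w2 - {0}"
    define r where "r = norm l"
    have r: "r > 0" using \<open>l \<in> _\<close> by (simp add: r_def)
    have taylor: "1 + \<delta> * r ^ 2 + (\<delta> * r ^ 2) ^ 2 / 2 \<le> exp (\<delta> * r ^ 2)"
      using \<delta> by (intro exp_lower_Taylor_quadratic) auto
    \<comment> \<open>Expanding gives 2 r^3 \<le> 2 r^2 + r^4, and both powers on the right occur in
      the quadratic Taylor bound for exp(\<delta> r^2).\<close>
    have "0 \<le> (r - r ^ 2) ^ 2 + r ^ 2" by simp
    then have "2 * r ^ 3 \<le> 2 * r ^ 2 + r ^ 4"
      by (simp add: power2_eq_square power3_eq_cube power4_eq_xxxx algebra_simps)
    also have "\<dots> = 2 * ((1 / \<delta>) * (\<delta> * r ^ 2) + (1 / \<delta> ^ 2) * ((\<delta> * r ^ 2) ^ 2 / 2))"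
      using \<delta> by (simp add: field_simps power_mult_distrib)
    also have "\<dots> \<le> 2 * ((1 / \<delta>) * exp (\<delta> * r ^ 2) + (1 / \<delta> ^ 2) * exp (\<delta> * r ^ 2))"
      using \<delta> zero_le_power2[of "\<delta> * r ^ 2"]
      by (intro mult_left_mono add_mono order_trans[OF _ taylor]) auto
    finally have "r ^ 3 \<le> (1 / \<delta> + 1 / \<delta> ^ 2) * exp (\<delta> * r ^ 2)"
      by (simp add: algebra_simps)
    then show "exp (- \<delta> * norm l ^ 2) \<le> (1 / \<delta> + 1 / \<delta> ^ 2) * (1 / norm l ^ 3)"
      using r by (simp add: exp_minus field_simps flip: r_def)
  qed auto
  \<comment> \<open>The inverse-cube majorant is 0 at the origin and cannot dominate there, so this
    one term is added separately.\<close>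
  then have "(\<lambda>l. exp (- \<delta> * norm l ^ 2)) summable_on insert 0 (lat w1 w2 - {0})"
    unfolding summable_on_insert_iff .
  also have "insert 0 (lat w1 w2 - {0}) = lat w1 w2"
    using zero_in_lattice[of w1 w2] by blast
  finally show ?thesis .
qed

section \<open>Covering radius and uniform Gaussian sums\<close>

text \<open>Rounding the real coordinates of z down leaves a remainder in the fundamental
  parallelogram.\<close>

lemma covering_radius:
  assumes "covol w1 w2 > 0"
  shows "\<exists>l\<in>lat w1 w2. norm (z - l) \<le> norm w1 + norm w2"
proof -
  define D where "D = Im (cnj w1 * w2)"
  \<comment> \<open>Cramer's rule: pairing z with each generator through Im(cnj u * v) isolates the
    other coordinate.\<close>
  define x where "x = - Im (cnj w2 * z) / D"
  define y where "y = Im (cnj w1 * z) / D"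
  have D: "D \<noteq> 0" using assms by (auto simp: covol_def D_def)
  have z: "z = of_real x * w1 + of_real y * w2"
  proof (rule complex_eqI)
    show "Re z = Re (of_real x * w1 + of_real y * w2)"
      using D by (simp add: x_def y_def field_simps) (simp add: D_def algebra_simps)
    show "Im z = Im (of_real x * w1 + of_real y * w2)"
      using D by (simp add: x_def y_def field_simps) (simp add: D_def algebra_simps)
  qed
  define l where "l = of_int \<lfloor>x\<rfloor> * w1 + of_int \<lfloor>y\<rfloor> * w2"
  have "z - l = of_real (frac x) * w1 + of_real (frac y) * w2"
    by (simp add: z l_def frac_def algebra_simps)
  also have "norm \<dots> \<le> frac x * norm w1 + frac y * norm w2"
    by (rule order_trans[OF norm_triangle_ineq]) (simp add: norm_mult)
  also have "\<dots> \<le> 1 * norm w1 + 1 * norm w2"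
    by (intro add_mono mult_right_mono) (auto simp: frac_lt_1 less_imp_le)
  finally show ?thesis
    unfolding lat_def l_def by auto
qed

lemma sq_norm_diff_le: "norm (x - y) ^ 2 \<le> 2 * norm (z - x) ^ 2 + 2 * norm (z - y :: 'a :: real_normed_vector) ^ 2"
proof -
  have "norm (x - y) \<le> norm (z - x) + norm (z - y)"
    using norm_triangle_ineq4[of "z - y" "z - x"] by simp
  then have "norm (x - y) ^ 2 \<le> (norm (z - x) + norm (z - y)) ^ 2"
    by (intro power_mono) auto
  also have "\<dots> \<le> 2 * norm (z - x) ^ 2 + 2 * norm (z - y) ^ 2"
    using sum_squares_bound[of "norm (z - x)" "norm (z - y)"] by (simp add: power2_sum)
  finally show ?thesis .
qed

text \<open>Replacing z by a lattice point \<open>l0\<close> within distance \<open>R\<close> halves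
  the rate and costs the factor exp(\<delta> R^2). Translation by \<open>l0\<close> permutes the
  lattice, so the resulting bound is the same for every z.\<close>

lemma lattice_gaussian_shifted:
  assumes "lin_indep_R w1 w2" "covol w1 w2 > 0" and \<delta>: "\<delta> > 0"
  obtains W where "\<And>z. (\<lambda>l. exp (- \<delta> * norm (z - l) ^ 2)) summable_on lat w1 w2"
    and "\<And>z. (\<Sum>\<^sub>\<infinity>l\<in>lat w1 w2. exp (- \<delta> * norm (z - l) ^ 2)) \<le> W"
proof -
  let ?L = "lat w1 w2"
  define R where "R = norm w1 + norm w2"
  let ?g = "\<lambda>l::complex. exp (\<delta> * R ^ 2) * exp (- (\<delta> / 2) * norm l ^ 2)"
  have g: "?g summable_on ?L"
    using \<delta> by (intro summable_on_cmult_right lattice_gaussian_summable assms) auto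
  have *: "(\<lambda>l. exp (- \<delta> * norm (z - l) ^ 2)) summable_on ?L \<and>
      (\<Sum>\<^sub>\<infinity>l\<in>?L. exp (- \<delta> * norm (z - l) ^ 2)) \<le> infsum ?g ?L" for z
  proof -
    obtain l0 where l0: "l0 \<in> ?L" "norm (z - l0) \<le> R"
      using covering_radius[OF assms(2)] by (auto simp: R_def)
    have s: "(\<lambda>l. ?g (l - l0)) summable_on ?L"
      using summable_on_reindex_bij_betw[OF lattice_shift_bij[OF l0(1)], of ?g] g by blast
    have le: "exp (- \<delta> * norm (z - l) ^ 2) \<le> ?g (l - l0)" for l
    proof -
      have "norm (l - l0) ^ 2 \<le> 2 * norm (z - l) ^ 2 + 2 * norm (z - l0) ^ 2"
        by (rule sq_norm_diff_le)
      also have "\<dots> \<le> 2 * norm (z - l) ^ 2 + 2 * R ^ 2"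
        using l0 by (simp add: power_mono)
      finally have "\<delta> / 2 * norm (l - l0) ^ 2 \<le> \<delta> / 2 * (2 * norm (z - l) ^ 2 + 2 * R ^ 2)"
        using \<delta> by (intro mult_left_mono) auto
      then show ?thesis by (simp add: algebra_simps flip: exp_add)
    qed
    have t: "(\<lambda>l. exp (- \<delta> * norm (z - l) ^ 2)) summable_on ?L"
      by (rule summable_on_comparison_test[OF s le]) auto
    have "(\<Sum>\<^sub>\<infinity>l\<in>?L. exp (- \<delta> * norm (z - l) ^ 2)) \<le> (\<Sum>\<^sub>\<infinity>l\<in>?L. ?g (l - l0))"
      by (rule infsum_mono[OF t s le])
    also have "\<dots> = infsum ?g ?L"
      by (rule infsum_reindex_bij_betw[OF lattice_shift_bij[OF l0(1)], of ?g])
    finally show ?thesis using t by blast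
  qed
  show thesis by (rule that[of "infsum ?g ?L"]) (use * in blast)+
qed

section \<open>The Weierstrass product over the lattice\<close>

lemma bij_betw_enum_lattice:
  assumes "lin_indep_R w1 w2"
  shows "bij_betw (from_nat_into (lat w1 w2 - {0})) UNIV (lat w1 w2 - {0})"
  by (rule bij_betw_from_nat_into) (use assms in \<open>auto simp: lattice_countable lattice_infinite\<close>)

lemma weierstrass_product_lattice:
  assumes "lin_indep_R w1 w2"
  shows "weierstrass_product (from_nat_into (lat w1 w2 - {0})) (\<lambda>_. 2)"
proof
  let ?e = "from_nat_into (lat w1 w2 - {0})"
  note bij = bij_betw_enum_lattice[OF assms]
  show nz: "?e n \<noteq> 0" for n
    using bij_betwE[OF bij] by auto
  have "(\<lambda>l. 1 / norm l ^ 3) summable_on (lat w1 w2 - {0})"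
    by (rule summable_on_subset_banach[OF lattice_summable_cube[OF assms]]) auto
  then have sm: "summable (\<lambda>n. 1 / norm (?e n) ^ 3)"
    using summable_on_reindex_bij_betw[OF bij, of "\<lambda>l. 1 / norm l ^ 3"]
    by (intro summable_on_imp_summable) simp
  show "summable (\<lambda>n. (r / norm (?e n)) ^ Suc 2)" for r :: real
    using summable_mult[OF sm, of "r ^ 3"] by (simp add: power_divide numeral_3_eq_3)
  show "filterlim ?e at_infinity at_top"
    unfolding filterlim_at_infinity_conv_norm_at_top filterlim_at_top
  proof
    fix Z :: real
    \<comment> \<open>A threshold of at least 1 is positive, so the inequality between reciprocals
      of cubes can be inverted.\<close>
    define Z' where "Z' = max Z 1"
    have "\<forall>\<^sub>F n in at_top. 1 / norm (?e n) ^ 3 < 1 / Z' ^ 3"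
      using summable_LIMSEQ_zero[OF sm] by (rule order_tendstoD) (simp add: Z'_def)
    then show "\<forall>\<^sub>F n in at_top. Z \<le> norm (?e n)"
    proof eventually_elim
      case (elim n)
      then have "Z' ^ 3 < norm (?e n) ^ 3"
        using nz[of n] by (simp add: Z'_def field_simps)
      then show ?case
        using power_less_imp_less_base[of Z' 3 "norm (?e n)"] by (simp add: Z'_def)
    qed
  qed
qed

text \<open>\<open>weier_prod\<close> is the canonical product with factors (1 - w) exp(w + w^2/2)
  at w = z/l, which is entire with zeros at the enumerated points. At z = 0 every factor is
  1.\<close>

lemma
  assumes "lin_indep_R w1 w2"
  shows weier_prod_entire: "weier_prod (lat w1 w2) holomorphic_on UNIV"
    and weier_prod_zero: "\<And>l. l \<in> lat w1 w2 - {0} \<Longrightarrow> weier_prod (lat w1 w2) l = 0"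
    and weier_prod_at_0: "weier_prod (lat w1 w2) 0 = 1"
proof -
  let ?e = "from_nat_into (lat w1 w2 - {0})"
  interpret W: weierstrass_product ?e "\<lambda>_. 2"
    by (rule weierstrass_product_lattice[OF assms])
  have "weier_prod (lat w1 w2) z = W.f z" for z
    unfolding weier_prod_def W.f_def Let_def weierstrass_factor_def
    by (simp add: numeral_2_eq_2 power_divide mult_ac)
  then have eq: "weier_prod (lat w1 w2) = W.f" by blast
  show "weier_prod (lat w1 w2) holomorphic_on UNIV"
    unfolding eq by (rule W.holomorphic)
  show "weier_prod (lat w1 w2) l = 0" if "l \<in> lat w1 w2 - {0}" for l
    using that bij_betw_imp_surj_on[OF bij_betw_enum_lattice[OF assms]]
    unfolding eq W.zero by blast
  show "weier_prod (lat w1 w2) 0 = 1"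
    by (simp add: weier_prod_def Let_def)
qed

subsection \<open>Superpositions of Gaussians\<close>

text \<open>Where k \<le> |z| \<le> k + 1, the Gaussian is at most exp(-\<delta> k^2), and the disc
  of radius k + 1 has area of order k^2; the resulting series converges faster than a geometric
  one.\<close>

lemma gaussian_nn_integral_finite:
  assumes \<delta>: "\<delta> > 0"
  shows "(\<integral>\<^sup>+ z. ennreal (exp (- \<delta> * norm (z::complex) ^ 2)) \<partial>lborel) < \<infinity>"
proof -
  let ?B = "\<lambda>k::nat. cball (0::complex) (real k + 1)"
  let ?f = "\<lambda>k z. ennreal (exp (- \<delta> * real k ^ 2)) * indicator (?B k) z"
  have le: "ennreal (exp (- \<delta> * norm z ^ 2)) \<le> (\<Sum>k. ?f k z)" for z
  proof -
    define k where "k = nat \<lfloor>norm z\<rfloor>"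
    have k: "real k \<le> norm z" "norm z \<le> real k + 1"
      unfolding k_def by auto
    have "ennreal (exp (- \<delta> * norm z ^ 2)) \<le> ?f k z"
      using k \<delta> by (auto simp: power_mono intro!: ennreal_leI)
    also have "\<dots> \<le> (\<Sum>k. ?f k z)"
      using sum_le_suminf[of "\<lambda>k. ?f k z" "{k}"] by (simp del: sum_mult_indicator)
    finally show ?thesis .
  qed
  have "(\<integral>\<^sup>+ z. ennreal (exp (- \<delta> * norm (z::complex) ^ 2)) \<partial>lborel) \<le> (\<integral>\<^sup>+ z. (\<Sum>k. ?f k z) \<partial>lborel)"
    by (intro nn_integral_mono le)
  also have "\<dots> = (\<Sum>k. \<integral>\<^sup>+ z. ?f k z \<partial>lborel)"
    by (rule nn_integral_suminf) (auto intro!: borel_measurable_times_ennreal borel_measurable_indicator)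
  also have "\<dots> = (\<Sum>k. ennreal (exp (- \<delta> * real k ^ 2)) * emeasure lborel (?B k))"
    by (simp add: nn_integral_cmult_indicator)
  also have "\<dots> = (\<Sum>k. ennreal (exp (- \<delta> * real k ^ 2) * (unit_ball_vol 2 * (real k + 1) ^ 2)))"
    by (simp add: emeasure_cball ennreal_mult)
  also have "\<dots> < \<infinity>"
  proof -
    have "summable (\<lambda>k. exp (- \<delta> * real k ^ 2) * (real k + 1) ^ 2)"
    proof (rule summable_comparison_test_bigo)
      show "summable (\<lambda>k. norm ((1 / 2 :: real) ^ k))" by simp
      show "(\<lambda>k. exp (- \<delta> * real k ^ 2) * (real k + 1) ^ 2) \<in> O(\<lambda>k. (1 / 2) ^ k)"
        using \<delta> by real_asymp
    qed
    from summable_mult[OF this, of "unit_ball_vol 2"] show ?thesis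
      by (subst suminf_ennreal2) (auto simp: mult_ac)
  qed
  finally show ?thesis .
qed

lemma nn_integral_lborel_translate:
  fixes l :: complex
  assumes [measurable]: "f \<in> borel_measurable borel"
  shows "(\<integral>\<^sup>+ z. f (z - l) \<partial>lborel) = (\<integral>\<^sup>+ z. f z \<partial>lborel)"
proof -
  have "(\<integral>\<^sup>+ z. f z \<partial>lborel) = (\<integral>\<^sup>+ z. f z \<partial>distr lborel borel ((+) (- l)))"
    by (simp add: lborel_distr_plus)
  also have "\<dots> = (\<integral>\<^sup>+ z. f (- l + z) \<partial>lborel)"
    by (rule nn_integral_distr) auto
  finally show ?thesis by simp
qed

text \<open>Splitting x w as (x sqrt w) sqrt w reduces every finite partial sum to the ordinary
  inequality. Summability comes from x \<le> x^2 + 1.\<close>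

lemma infsum_Cauchy_Schwarz_weighted:
  fixes x w :: "'a \<Rightarrow> real"
  assumes "\<And>i. i \<in> A \<Longrightarrow> 0 \<le> w i" "\<And>i. i \<in> A \<Longrightarrow> 0 \<le> x i"
    and "w summable_on A" "(\<lambda>i. x i ^ 2 * w i) summable_on A"
  shows "(\<lambda>i. x i * w i) summable_on A"
    and "(\<Sum>\<^sub>\<infinity>i\<in>A. x i * w i) ^ 2 \<le> (\<Sum>\<^sub>\<infinity>i\<in>A. x i ^ 2 * w i) * (\<Sum>\<^sub>\<infinity>i\<in>A. w i)"
proof -
  let ?S = "\<Sum>\<^sub>\<infinity>i\<in>A. x i ^ 2 * w i" and ?W = "\<Sum>\<^sub>\<infinity>i\<in>A. w i"
  have "(\<lambda>i. x i ^ 2 * w i + w i) summable_on A"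
    using assms by (intro summable_on_add)
  then show sm: "(\<lambda>i. x i * w i) summable_on A"
  proof (rule summable_on_comparison_test)
    fix i assume i: "i \<in> A"
    have "x i * 1 \<le> x i ^ 2 + 1" using sum_squares_bound[of "x i" 1] zero_le_power2[of "x i"] assms(2)[OF i]
      by simp
    then have "x i * 1 * w i \<le> (x i ^ 2 + 1) * w i"
      using assms(1)[OF i] by (intro mult_right_mono)
    then show "x i * w i \<le> x i ^ 2 * w i + w i" by (simp add: algebra_simps)
  qed (use assms in auto)
  have W: "0 \<le> ?W" and S: "0 \<le> ?S" using assms by (auto intro!: infsum_nonneg)
  have "infsum (\<lambda>i. x i * w i) A \<le> sqrt (?S * ?W)"
  proof (rule infsum_le_finite_sums[OF sm])
    fix X assume X: "finite X" "X \<subseteq> A"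
    have "(\<Sum>i\<in>X. (x i * sqrt (w i)) * sqrt (w i)) ^ 2 \<le>
        (\<Sum>i\<in>X. (x i * sqrt (w i)) ^ 2) * (\<Sum>i\<in>X. sqrt (w i) ^ 2)"
      by (rule Cauchy_Schwarz_ineq_sum)
    also have "(\<Sum>i\<in>X. (x i * sqrt (w i)) * sqrt (w i)) = (\<Sum>i\<in>X. x i * w i)"
      using X assms by (intro sum.cong) (auto simp: mult.assoc)
    also have "(\<Sum>i\<in>X. (x i * sqrt (w i)) ^ 2) = (\<Sum>i\<in>X. x i ^ 2 * w i)"
      using X assms by (intro sum.cong) (auto simp: power_mult_distrib)
    also have "(\<Sum>i\<in>X. sqrt (w i) ^ 2) = (\<Sum>i\<in>X. w i)"
      using X assms by (intro sum.cong) auto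
    also have "(\<Sum>i\<in>X. x i ^ 2 * w i) * (\<Sum>i\<in>X. w i) \<le> ?S * ?W"
      using X assms by (intro mult_mono finite_sum_le_infsum S sum_nonneg) auto
    finally show "(\<Sum>i\<in>X. x i * w i) \<le> sqrt (?S * ?W)"
      by (rule real_le_rsqrt)
  qed
  moreover have "0 \<le> infsum (\<lambda>i. x i * w i) A"
    using assms by (intro infsum_nonneg) auto
  ultimately have "infsum (\<lambda>i. x i * w i) A ^ 2 \<le> sqrt (?S * ?W) ^ 2"
    by (intro power_mono)
  then show "infsum (\<lambda>i. x i * w i) A ^ 2 \<le> ?S * ?W"
    using W S by simp
qed

text \<open>Sum and integral of nonnegative terms may be exchanged, and by translation invariance
  all the Gaussians have the same finite integral; the total is the sum of \<open>b\<close> times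
  that integral.\<close>

lemma integrable_gaussian_superposition:
  fixes b :: "complex \<Rightarrow> real" and L :: "complex set"
  assumes L: "countable L" "infinite L" and \<delta>: "\<delta> > 0"
    and b: "\<And>l. l \<in> L \<Longrightarrow> 0 \<le> b l" "b summable_on L"
    and sm: "\<And>z. (\<lambda>l. b l * exp (- \<delta> * norm (z - l) ^ 2)) summable_on L"
  shows "integrable lborel (\<lambda>z. \<Sum>\<^sub>\<infinity>l\<in>L. b l * exp (- \<delta> * norm (z - l) ^ 2))"
proof -
  define e where "e = from_nat_into L"
  have bij: "bij_betw e UNIV L"
    unfolding e_def using L by (rule bij_betw_from_nat_into)
  then have eL: "e k \<in> L" for k by (auto simp: bij_betw_def)
  let ?t = "\<lambda>k z. b (e k) * exp (- \<delta> * norm (z - e k) ^ 2)"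
  let ?I = "\<integral>\<^sup>+ z. ennreal (exp (- \<delta> * norm (z::complex) ^ 2)) \<partial>lborel"
  have sums: "(\<lambda>k. ?t k z) sums (\<Sum>\<^sub>\<infinity>l\<in>L. b l * exp (- \<delta> * norm (z - l) ^ 2))" for z
    using has_sum_reindex_bij_betw[OF bij, of "\<lambda>l. b l * exp (- \<delta> * norm (z - l) ^ 2)"] sm[of z]
    by (intro has_sum_imp_sums) simp
  have eq: "(\<lambda>z. \<Sum>\<^sub>\<infinity>l\<in>L. b l * exp (- \<delta> * norm (z - l) ^ 2)) = (\<lambda>z. \<Sum>k. ?t k z)"
    using sums by (auto simp: sums_iff)
  have bs: "summable (\<lambda>k. b (e k))"
    using summable_on_reindex_bij_betw[OF bij, of b] b by (intro summable_on_imp_summable) simp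
  show ?thesis
    unfolding eq
  proof (rule integrableI_nonneg)
    show "AE z in lborel. 0 \<le> (\<Sum>k. ?t k z)"
      using sums b(1)[OF eL] by (intro AE_I2 suminf_nonneg) (auto simp: sums_iff)
    have "(\<integral>\<^sup>+ z. ennreal (\<Sum>k. ?t k z) \<partial>lborel) = (\<integral>\<^sup>+ z. (\<Sum>k. ennreal (?t k z)) \<partial>lborel)"
      using sums b(1)[OF eL] by (subst suminf_ennreal2) (auto simp: sums_iff)
    also have "\<dots> = (\<Sum>k. \<integral>\<^sup>+ z. ennreal (?t k z) \<partial>lborel)"
      by (rule nn_integral_suminf) measurable
    also have "\<dots> = (\<Sum>k. ennreal (b (e k)) * ?I)"
    proof (rule suminf_cong)
      fix k
      have "(\<integral>\<^sup>+ z. ennreal (?t k z) \<partial>lborel) =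
          (\<integral>\<^sup>+ z. ennreal (b (e k)) * ennreal (exp (- \<delta> * norm (z - e k) ^ 2)) \<partial>lborel)"
        using b(1)[OF eL] by (simp add: ennreal_mult)
      also have "\<dots> = ennreal (b (e k)) * (\<integral>\<^sup>+ z. ennreal (exp (- \<delta> * norm (z - e k) ^ 2)) \<partial>lborel)"
        by (rule nn_integral_cmult) measurable
      also have "(\<integral>\<^sup>+ z. ennreal (exp (- \<delta> * norm (z - e k) ^ 2)) \<partial>lborel) = ?I"
        by (rule nn_integral_lborel_translate) measurable
      finally show "(\<integral>\<^sup>+ z. ennreal (?t k z) \<partial>lborel) = ennreal (b (e k)) * ?I" .
    qed
    also have "\<dots> = ennreal (\<Sum>k. b (e k)) * ?I"
      using bs b(1)[OF eL] by (simp add: suminf_ennreal2)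
    also have "\<dots> < \<infinity>"
      using gaussian_nn_integral_finite[OF \<delta>] by (simp add: ennreal_mult_less_top)
    finally show "(\<integral>\<^sup>+ z. ennreal (\<Sum>k. ?t k z) \<partial>lborel) < \<infinity>" .
  qed measurable
qed

subsection \<open>The interpolating function\<close>

lemma msigma_quot_entire:
  assumes "lin_indep_R w1 w2"
  shows "msigma_quot (lat w1 w2) a holomorphic_on UNIV"
  unfolding msigma_quot_def[abs_def]
  by (intro holomorphic_intros weier_prod_entire[OF assms])

lemma sigma_pow_quot_entire:
  assumes "lin_indep_R w1 w2"
  shows "sigma_pow_quot (lat w1 w2) a n holomorphic_on UNIV"
  unfolding sigma_pow_quot_def[abs_def]
  by (intro holomorphic_intros msigma_quot_entire[OF assms]) auto

text \<open>Two factorizations of the same function: at 0 it is w^n times a cofactor with value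
  1/n!, while at the other lattice points it is a multiple of the (n+1)-st power of a function
  vanishing there.\<close>

lemma fock_deriv_sigma_lattice:
  assumes "lin_indep_R w1 w2" "l \<in> lat w1 w2"
  shows "fock_deriv n (sigma_pow_quot (lat w1 w2) a n) l = (if l = 0 then 1 else 0)"
proof -
  let ?Q = "msigma_quot (lat w1 w2) a"
  note Q = msigma_quot_entire[OF assms(1), of a]
  show ?thesis
  proof (cases "l = 0")
    case True
    have "sigma_pow_quot (lat w1 w2) a n = (\<lambda>w. w ^ n * (?Q w ^ (n + 1) / fact n))"
      by (auto simp: sigma_pow_quot_def)
    moreover have "(\<lambda>w. ?Q w ^ (n + 1) / fact n) holomorphic_on UNIV"
      by (intro holomorphic_intros Q) auto
    moreover have "?Q 0 = 1"
      using weier_prod_at_0[OF assms(1)] by (simp add: msigma_quot_def)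
    ultimately show ?thesis
      using True by (simp only: fock_deriv_at_0 higher_deriv_power_mult_at_0) simp
  next
    case False
    have "sigma_pow_quot (lat w1 w2) a n = (\<lambda>w. w ^ n / fact n * ?Q w ^ (n + 1))"
      by (auto simp: sigma_pow_quot_def)
    moreover have "(\<lambda>w::complex. w ^ n / fact n) holomorphic_on UNIV"
      by (intro holomorphic_intros) auto
    moreover have "?Q l = 0"
      using weier_prod_zero[OF assms(1)] assms(2) False by (simp add: msigma_quot_def)
    ultimately have "fock_deriv n (sigma_pow_quot (lat w1 w2) a n) l = 0"
      by (simp only: higher_deriv_mult_power_zero[OF _ Q] fock_deriv_zero less_Suc_eq_le Suc_eq_plus1[symmetric])
    then show ?thesis using False by simp
  qed
qed

text \<open>Outside the unit disc the division by n! z only decreases the modulus; inside it,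
  compactness gives a constant bound.\<close>

lemma sigma_pow_quot_growth:
  assumes "lin_indep_R w1 w2" "s > 0"
    and "\<And>z. norm (msigma (lat w1 w2) a z) \<le> C * exp (pi / (2 * s) * norm z ^ 2)"
  shows "\<exists>C'. \<forall>z. norm (sigma_pow_quot (lat w1 w2) a n z) \<le> C' * exp (real (n + 1) * (pi / (2 * s)) * norm z ^ 2)"
proof -
  let ?g = "sigma_pow_quot (lat w1 w2) a n"
  let ?E = "\<lambda>z::complex. exp (real (n + 1) * (pi / (2 * s)) * norm z ^ 2)"
  have C: "0 \<le> C" using order_trans[OF norm_ge_zero assms(3)[of 0]] by simp
  have "compact (?g ` cball 0 1)"
    using sigma_pow_quot_entire[OF assms(1)]
    by (intro compact_continuous_image holomorphic_on_imp_continuous_on) (auto intro: holomorphic_on_subset)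
  then obtain B where B: "\<And>z. norm z \<le> 1 \<Longrightarrow> norm (?g z) \<le> B"
    by (meson bounded_iff compact_imp_bounded image_eqI mem_cball_0)
  have B0: "0 \<le> B" using order_trans[OF norm_ge_zero B[of 0]] by simp
  have "norm (?g z) \<le> (C ^ (n + 1) + B) * ?E z" for z
  proof (cases "norm z \<le> 1")
    case True
    have "norm (?g z) \<le> B * 1" using B[OF True] by simp
    also have "\<dots> \<le> (C ^ (n + 1) + B) * ?E z"
      using C B0 assms(2) by (intro mult_mono) auto
    finally show ?thesis .
  next
    case False
    then have "z \<noteq> 0" by auto
    then have "norm (?g z) = norm (msigma (lat w1 w2) a z) ^ (n + 1) / (fact n * norm z)"
      by (simp add: sigma_pow_quot_eq norm_divide norm_mult norm_power)
    also have "\<dots> \<le> norm (msigma (lat w1 w2) a z) ^ (n + 1) / 1"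
    proof (rule divide_left_mono)
      show "1 \<le> fact n * norm z"
        using False mult_mono[of 1 "fact n" 1 "norm z"] by simp
    qed (use \<open>z \<noteq> 0\<close> in auto)
    also have "\<dots> \<le> (C * exp (pi / (2 * s) * norm z ^ 2)) ^ (n + 1)"
      using assms(3)[of z] by (simp only: div_by_1) (intro power_mono, auto)
    also have "\<dots> = C ^ (n + 1) * ?E z"
      by (simp only: power_mult_distrib flip: exp_of_nat_mult) (simp add: mult.assoc)
    also have "\<dots> \<le> (C ^ (n + 1) + B) * ?E z"
      using B0 by (intro mult_right_mono) auto
    finally show ?thesis .
  qed
  then show ?thesis by blast
qed

lemma gauss_minus_cancel: "gauss c z * gauss (- c) z = 1"
  by (simp add: gauss_def flip: of_real_mult exp_add)

lemma S_fun_eq_fock_deriv: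
  assumes "lin_indep_R w1 w2"
  shows "S_fun (lat w1 w2) a n z = fock_deriv n (sigma_pow_quot (lat w1 w2) a n) z"
  unfolding S_fun_def wirtinger_power_gauss[OF sigma_pow_quot_entire[OF assms]]
  by (simp add: gauss_minus_cancel flip: mult.assoc)

lemma fock_deriv_scale:
  assumes "H holomorphic_on UNIV"
  shows "fock_deriv n (\<lambda>w. k * H w) z = k * fock_deriv n H z"
  using fock_deriv_lincomb[OF assms assms, of n k 0 z] by simp

section \<open>Membership in the Fock space and bounds for shifts\<close>

text \<open>The normalizing constant of the space is nonzero, so it is absorbed by dividing
  \<open>H\<close> by it.\<close>

lemma fock_deriv_in_true_poly_fock:
  assumes H: "H holomorphic_on UNIV"
    and "integrable lborel (\<lambda>z. norm (fock_deriv n H z) ^ 2 * exp (- pi * norm z ^ 2))"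
  shows "fock_deriv n H \<in> true_poly_fock n"
proof -
  define k where "k = complex_of_real (sqrt (pi ^ n / fact n))"
  have k: "k \<noteq> 0" by (simp add: k_def)
  have hol: "(\<lambda>w. (1 / k) * H w) holomorphic_on UNIV"
    by (intro holomorphic_intros H)
  have "fock_deriv n H z = k * gauss pi z * (wirtinger ^^ n) (\<lambda>w. gauss (- pi) w * ((1 / k) * H w)) z" for z
  proof -
    have "k * gauss pi z * (wirtinger ^^ n) (\<lambda>w. gauss (- pi) w * ((1 / k) * H w)) z =
        (gauss pi z * gauss (- pi) z) * (k * ((1 / k) * fock_deriv n H z))"
      unfolding wirtinger_power_gauss[OF hol] fock_deriv_scale[OF H] by (simp only: mult_ac)
    then show ?thesis using k by (simp add: gauss_minus_cancel)
  qed
  then show ?thesis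
    using assms hol unfolding true_poly_fock_def k_def by blast
qed

text \<open>Expanding |z - l|^2 turns the real part of the exponent into a difference of squares:
  the shift carries the weight centred at l to the one centred at 0.\<close>

lemma norm_exp_shift:
  "norm (exp (of_real pi * cnj l * z - of_real (pi * norm l ^ 2 / 2))) =
     exp (pi / 2 * norm z ^ 2) * exp (- (pi / 2) * norm (z - l) ^ 2)"
proof -
  have "norm (z - l) ^ 2 = norm z ^ 2 + norm l ^ 2 - 2 * Re (cnj l * z)"
    unfolding cmod_power2 by (simp add: power2_eq_square algebra_simps)
  moreover have "Re (of_real pi * cnj l * z) = pi * Re (cnj l * z)"
    by (simp add: mult.assoc del: complex_cnj_mult)
  ultimately have "Re (of_real pi * cnj l * z - of_real (pi * norm l ^ 2 / 2)) =
      pi / 2 * norm z ^ 2 + - (pi / 2) * norm (z - l) ^ 2"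
    by (simp only: minus_complex.sel Re_complex_of_real) (simp add: algebra_simps)
  then show ?thesis
    by (simp only: norm_exp_eq_Re exp_add)
qed

lemma shifted_term_bound:
  assumes G: "\<And>w. norm (G w) \<le> C * exp ((pi / 2 - \<delta>) * norm w ^ 2)"
  shows "norm (c * exp (of_real pi * cnj l * z - of_real (pi * norm l ^ 2 / 2)) * G (z - l))
     \<le> C * exp (pi / 2 * norm z ^ 2) * (norm c * exp (- \<delta> * norm (z - l) ^ 2))"
proof -
  have "norm (c * exp (of_real pi * cnj l * z - of_real (pi * norm l ^ 2 / 2)) * G (z - l)) =
      norm c * (exp (pi / 2 * norm z ^ 2) * exp (- (pi / 2) * norm (z - l) ^ 2)) * norm (G (z - l))"
    by (simp only: norm_mult norm_exp_shift)
  also have "\<dots> \<le> norm c * (exp (pi / 2 * norm z ^ 2) * exp (- (pi / 2) * norm (z - l) ^ 2)) *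
      (C * exp ((pi / 2 - \<delta>) * norm (z - l) ^ 2))"
    by (intro mult_left_mono G) auto
  also have "\<dots> = C * exp (pi / 2 * norm z ^ 2) * (norm c *
      (exp (- (pi / 2) * norm (z - l) ^ 2) * exp ((pi / 2 - \<delta>) * norm (z - l) ^ 2)))"
    by (simp only: mult_ac)
  also have "exp (- (pi / 2) * norm (z - l) ^ 2) * exp ((pi / 2 - \<delta>) * norm (z - l) ^ 2) = exp (- \<delta> * norm (z - l) ^ 2)"
    by (simp add: algebra_simps flip: exp_add)
  finally show ?thesis .
qed

lemma sigma_interpolation:
  fixes c :: "complex \<Rightarrow> complex"
  assumes indep: "lin_indep_R w1 w2"
    and area: "covol w1 w2 > real n + 1"
    and a_growth: "\<And>z. norm (msigma (lat w1 w2) a z) \<le> C * exp (pi / (2 * covol w1 w2) * norm z ^ 2)"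
    and c: "(\<lambda>l. norm (c l) ^ 2) summable_on lat w1 w2"
  defines "F \<equiv> \<lambda>z. \<Sum>\<^sub>\<infinity>l\<in>lat w1 w2. interp_term (lat w1 w2) a n c z l"
  shows "\<forall>z. interp_term (lat w1 w2) a n c z summable_on lat w1 w2"
    and "F \<in> true_poly_fock n"
    and "\<forall>l\<in>lat w1 w2. F l * gauss (- pi / 2) l = c l"
proof -
  let ?L = "lat w1 w2"
  let ?g = "sigma_pow_quot ?L a n"
  let ?T = "interp_term ?L a n c"
  define \<alpha> where "\<alpha> = real (n + 1) * (pi / (2 * covol w1 w2))"
  \<comment> \<open>The area hypothesis amounts to \<alpha> < pi/2. Half of this gap becomes the
    Gaussian rate; the other half keeps \<alpha> < pi/2 - \<delta> strict, as the growth estimate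
    requires.\<close>
  define \<delta> where "\<delta> = (pi / 2 - \<alpha>) / 2"
  have s: "covol w1 w2 > 0" using area by simp
  have \<alpha>: "0 \<le> \<alpha>" "\<alpha> < pi / 2"
    using area s mult_strict_left_mono[OF area pi_gt_zero] by (auto simp: \<alpha>_def field_simps)
  have \<delta>: "\<delta> > 0" "\<alpha> < pi / 2 - \<delta>"
    using \<alpha> by (auto simp: \<delta>_def field_simps)
  have g: "?g holomorphic_on UNIV" by (rule sigma_pow_quot_entire[OF indep])
  obtain C0 where C0: "\<And>z. norm (?g z) \<le> C0 * exp (\<alpha> * norm z ^ 2)"
    using sigma_pow_quot_growth[OF indep s a_growth] unfolding \<alpha>_def by blast
  \<comment> \<open>Order 0 of the growth estimate merely raises the exponent. \<open>C1\<close>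
    will control the holomorphic series, \<open>C2\<close> its image under the operator.\<close>
  obtain C1 where C1: "\<And>z. norm (?g z) \<le> C1 * exp ((pi / 2 - \<delta>) * norm z ^ 2)"
    using fock_deriv_growth[OF g C0 \<alpha>(1) \<delta>(2), of 0] by auto
  obtain C2 where C2: "\<And>z. norm (fock_deriv n ?g z) \<le> C2 * exp ((pi / 2 - \<delta>) * norm z ^ 2)"
    using fock_deriv_growth[OF g C0 \<alpha>(1) \<delta>(2)] by blast
  have C1_nonneg: "0 \<le> C1" using order_trans[OF norm_ge_zero C1[of 0]] by simp
  have C2_nonneg: "0 \<le> C2" using order_trans[OF norm_ge_zero C2[of 0]] by simp
  obtain W where W: "\<And>z. (\<lambda>l. exp (- \<delta> * norm (z - l) ^ 2)) summable_on ?L"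
      "\<And>z. (\<Sum>\<^sub>\<infinity>l\<in>?L. exp (- \<delta> * norm (z - l) ^ 2)) \<le> W"
    using lattice_gaussian_shifted[OF indep s \<delta>(1)] by blast
  \<comment> \<open>The l^2 norm bounds every single coefficient.\<close>
  define K where "K = sqrt (\<Sum>\<^sub>\<infinity>l\<in>?L. norm (c l) ^ 2)"
  have K: "norm (c l) \<le> K" if "l \<in> ?L" for l
    unfolding K_def using finite_sum_le_infsum[OF c, of "{l}"] that by (intro real_le_rsqrt) auto

  \<comment> \<open>The constant exp(-pi |l|^2/2) is kept apart from the exponential in z, so that
    scaling and shift covariance apply one after the other.\<close>
  define H where "H = (\<lambda>l z. c l * exp (- of_real (pi * norm l ^ 2 / 2)) *
    (exp (of_real pi * cnj l * z) * ?g (z - l)))"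
  have exp_split: "exp (x - y) = exp (- y) * exp x" for x y :: complex
    by (simp flip: exp_add)
  have H_eq: "H l z = c l * exp (of_real pi * cnj l * z - of_real (pi * norm l ^ 2 / 2)) * ?g (z - l)" for l z
    unfolding H_def exp_split by (simp only: mult_ac)
  have T: "?T z l = c l * exp (of_real pi * cnj l * z - of_real (pi * norm l ^ 2 / 2)) * fock_deriv n ?g (z - l)" for l z
    unfolding interp_term_def S_fun_eq_fock_deriv[OF indep] ..
  have fock_H: "fock_deriv n (H l) z = ?T z l" for l z
    unfolding H_def T fock_deriv_scale[OF entire_translate[OF g]] fock_deriv_shift[OF g]
    unfolding exp_split by (simp only: mult_ac)

  have ls: "locally_summable H ?L"
    unfolding locally_summable_def
  proof (intro conjI ballI allI)
    fix l show "H l holomorphic_on UNIV"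
      unfolding H_def by (intro holomorphic_intros entire_translate[OF g])
  next
    fix R :: real
    \<comment> \<open>For |z| \<le> R, |l|^2 \<le> 2 |z - l|^2 + 2 R^2 replaces the Gaussian about z
      by one about 0 with half the rate.\<close>
    define M where "M = (\<lambda>l::complex. C1 * exp (pi / 2 * R ^ 2) * K * exp (\<delta> * R ^ 2) * exp (- (\<delta> / 2) * norm l ^ 2))"
    have "M summable_on ?L"
      unfolding M_def using \<delta> by (intro summable_on_cmult_right lattice_gaussian_summable indep) auto
    moreover have "norm (H l z) \<le> M l" if l: "l \<in> ?L" and z: "z \<in> cball 0 R" for l z
    proof -
      have zR: "norm z ^ 2 \<le> R ^ 2" using z by (intro power_mono) auto
      have "norm l ^ 2 \<le> 2 * norm (z - l) ^ 2 + 2 * R ^ 2"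
        using sq_norm_diff_le[of l 0 z] zR by simp
      then have "\<delta> / 2 * norm l ^ 2 \<le> \<delta> / 2 * (2 * norm (z - l) ^ 2 + 2 * R ^ 2)"
        using \<delta> by (intro mult_left_mono) auto
      then have "exp (- \<delta> * norm (z - l) ^ 2) \<le> exp (\<delta> * R ^ 2) * exp (- (\<delta> / 2) * norm l ^ 2)"
        by (simp add: algebra_simps flip: exp_add)
      then have c_le: "norm (c l) * exp (- \<delta> * norm (z - l) ^ 2) \<le> K * (exp (\<delta> * R ^ 2) * exp (- (\<delta> / 2) * norm l ^ 2))"
        using K[OF l] order_trans[OF norm_ge_zero K[OF l]] by (intro mult_mono) auto
      have z_le: "C1 * exp (pi / 2 * norm z ^ 2) \<le> C1 * exp (pi / 2 * R ^ 2)"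
        using zR C1_nonneg by (intro mult_left_mono) auto
      have "C1 * exp (pi / 2 * norm z ^ 2) * (norm (c l) * exp (- \<delta> * norm (z - l) ^ 2)) \<le>
          C1 * exp (pi / 2 * R ^ 2) * (K * (exp (\<delta> * R ^ 2) * exp (- (\<delta> / 2) * norm l ^ 2)))"
        using C1_nonneg by (intro mult_mono[OF z_le c_le]) auto
      then show ?thesis
        unfolding H_eq M_def using shifted_term_bound[OF C1, where c = "c l" and l = l and z = z]
        by (simp only: mult.assoc)
    qed
    ultimately show "\<exists>M. M summable_on ?L \<and> (\<forall>l\<in>?L. \<forall>z\<in>cball 0 R. norm (H l z) \<le> M l)"
      by blast
  qed
  define G where "G = (\<lambda>z. \<Sum>\<^sub>\<infinity>l\<in>?L. H l z)"
  have G: "G holomorphic_on UNIV"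
    unfolding G_def by (rule locally_summable_infsum_entire[OF ls])
  have hs: "(?T z has_sum fock_deriv n G z) ?L" for z
    using fock_deriv_has_sum[OF ls, of n z] unfolding fock_H G_def .
  then show "\<forall>z. ?T z summable_on ?L"
    by (auto simp: summable_on_def)
  have F_eq: "F = fock_deriv n G"
    unfolding F_def using hs by (auto intro: infsumI)

  have c2: "(\<lambda>l. norm (c l) ^ 2 * exp (- \<delta> * norm (z - l) ^ 2)) summable_on ?L" for z
    by (rule summable_on_comparison_test[OF c]) (use \<delta> in \<open>auto intro!: mult_left_le\<close>)
  let ?S = "\<lambda>z. \<Sum>\<^sub>\<infinity>l\<in>?L. norm (c l) ^ 2 * exp (- \<delta> * norm (z - l) ^ 2)"
  have int: "integrable lborel (\<lambda>z. C2 ^ 2 * W * ?S z)"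
    using c c2 \<delta> lattice_countable lattice_infinite[OF indep]
    by (intro integrable_mult_right integrable_gaussian_superposition) auto
  \<comment> \<open>Cauchy-Schwarz with the Gaussian weights, whose sum is at most \<open>W\<close>.
    Squaring exp(pi/2 |z|^2) gives exactly the factor that the Fock weight cancels.\<close>
  have bound: "norm (norm (F z) ^ 2 * exp (- pi * norm z ^ 2)) \<le> norm (C2 ^ 2 * W * ?S z)" for z
  proof -
    let ?A = "\<Sum>\<^sub>\<infinity>l\<in>?L. norm (c l) * exp (- \<delta> * norm (z - l) ^ 2)"
    note CS = infsum_Cauchy_Schwarz_weighted[of ?L "\<lambda>l. exp (- \<delta> * norm (z - l) ^ 2)" "\<lambda>l. norm (c l)", OF _ _ W(1) c2]
    have dom: "(\<lambda>l. C2 * exp (pi / 2 * norm z ^ 2) * (norm (c l) * exp (- \<delta> * norm (z - l) ^ 2))) summable_on ?L"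
      by (intro summable_on_cmult_right CS(1)) auto
    have le: "norm (?T z l) \<le> C2 * exp (pi / 2 * norm z ^ 2) * (norm (c l) * exp (- \<delta> * norm (z - l) ^ 2))" for l
      unfolding T by (rule shifted_term_bound[OF C2])
    have abs: "(\<lambda>l. norm (?T z l)) summable_on ?L"
      by (rule summable_on_comparison_test[OF dom le]) auto
    have "norm (F z) \<le> (\<Sum>\<^sub>\<infinity>l\<in>?L. norm (?T z l))"
      unfolding F_def by (rule norm_infsum_bound[OF abs])
    also have "\<dots> \<le> (\<Sum>\<^sub>\<infinity>l\<in>?L. C2 * exp (pi / 2 * norm z ^ 2) * (norm (c l) * exp (- \<delta> * norm (z - l) ^ 2)))"
      by (rule infsum_mono[OF abs dom le])
    also have "\<dots> = C2 * exp (pi / 2 * norm z ^ 2) * ?A"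
      by (rule infsum_cmult_right')
    finally have "norm (F z) ^ 2 \<le> (C2 * exp (pi / 2 * norm z ^ 2) * ?A) ^ 2"
      by (intro power_mono) auto
    also have "\<dots> = C2 ^ 2 * exp (pi * norm z ^ 2) * ?A ^ 2"
      by (simp add: power_mult_distrib flip: exp_of_nat_mult)
    also have "\<dots> \<le> C2 ^ 2 * exp (pi * norm z ^ 2) * (?S z * W)"
      using CS(2) W(2)[of z]
      by (intro mult_left_mono order_trans[OF CS(2)]) (auto intro!: infsum_nonneg)
    finally have "norm (F z) ^ 2 * exp (- pi * norm z ^ 2) \<le>
        C2 ^ 2 * exp (pi * norm z ^ 2) * (?S z * W) * exp (- pi * norm z ^ 2)"
      by (rule mult_right_mono) auto
    also have "\<dots> = C2 ^ 2 * W * ?S z"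
      by (simp add: exp_minus)
    finally show ?thesis by simp
  qed
  have meas: "(\<lambda>z. norm (F z) ^ 2 * exp (- pi * norm z ^ 2)) \<in> borel_measurable lborel"
    unfolding F_eq using continuous_fock_deriv[OF G]
    by (intro borel_measurable_continuous_onI continuous_intros | simp)+
  have "integrable lborel (\<lambda>z. norm (F z) ^ 2 * exp (- pi * norm z ^ 2))"
    by (rule Bochner_Integration.integrable_bound[OF int meas AE_I2[OF bound]])
  then show "F \<in> true_poly_fock n"
    unfolding F_eq by (rule fock_deriv_in_true_poly_fock[OF G])

  show "\<forall>l\<in>?L. F l * gauss (- pi / 2) l = c l"
  proof
    fix l assume l: "l \<in> ?L"
    \<comment> \<open>For m different from l, l - m is a nonzero lattice point, where the operator's
      image vanishes; only the diagonal term remains.\<close>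
    have "(?T l has_sum ?T l l) ?L"
    proof (rule has_sum_finite_neutralI[of "{l}"])
      fix m assume "m \<in> ?L - {l}"
      then show "?T l m = 0"
        unfolding T using l by (auto simp: fock_deriv_sigma_lattice[OF indep] lattice_diff)
    qed (use l in auto)
    then have "F l = ?T l l"
      unfolding F_def by (rule infsumI)
    also have "\<dots> = c l * gauss (pi / 2) l"
    proof -
      \<comment> \<open>On the diagonal the exponent is pi |l|^2 - pi |l|^2/2, the inverse of the
        weight in the interpolation condition.\<close>
      have "of_real pi * cnj l * l - of_real (pi * norm l ^ 2 / 2) = complex_of_real (pi / 2 * norm l ^ 2)"
        using complex_norm_square[of l] by (simp add: field_simps)
      then show ?thesis
        by (simp only: T gauss_def diff_self fock_deriv_sigma_lattice[OF indep zero_in_lattice] exp_of_real) simp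
    qed
    finally show "F l * gauss (- pi / 2) l = c l"
      using gauss_minus_cancel[of "pi / 2" l] by simp
  qed
qed

theorem theorem1:
  fixes n :: nat and w1 w2 a :: complex
  assumes indep: "lin_indep_R w1 w2"
    and area: "covol w1 w2 > real n + 1"
    and a_growth: "\<exists>C. \<forall>z. norm (msigma (lat w1 w2) a z) \<le> C * exp (pi / (2 * covol w1 w2) * norm z ^ 2)"
  shows "\<forall>c :: complex \<Rightarrow> complex. (\<lambda>l. norm (c l) ^ 2) summable_on lat w1 w2 \<longrightarrow>
           (\<exists>F \<in> true_poly_fock n. \<forall>l \<in> lat w1 w2. F l * gauss (- pi / 2) l = c l) \<and>
           (\<forall>z. interp_term (lat w1 w2) a n c z summable_on lat w1 w2) \<and>
           (\<lambda>z. \<Sum>\<^sub>\<infinity>l \<in> lat w1 w2. interp_term (lat w1 w2) a n c z l) \<in> true_poly_fock n \<and>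
           (\<forall>l \<in> lat w1 w2. (\<Sum>\<^sub>\<infinity>m \<in> lat w1 w2. interp_term (lat w1 w2) a n c l m) * gauss (- pi / 2) l = c l)"
proof -
  obtain C where C: "\<And>z. norm (msigma (lat w1 w2) a z) \<le> C * exp (pi / (2 * covol w1 w2) * norm z ^ 2)"
    using a_growth by blast
  show ?thesis
  proof (intro allI impI, goal_cases)
    case (1 c)
    note F = sigma_interpolation[OF indep area C 1]
    show ?case
      \<comment> \<open>The sum of the series is itself the witness for the existence claim.\<close>
      by (intro conjI bexI[OF _ F(2)] F)
  qed
qed

end
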